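(* Let $\rho_0\in\mathcal P(\mathbb R)$ be compactly supported with density $\rho_0\in L^\infty(\mathbb R)$, and set $R=\|\rho_0\|_{L^\infty(\mathbb R)}$. Assume in addition to the standing assumptions that (i) $V(x)>0$ for all $x\le0$, (ii) $V$ is non-decreasing on $(-\infty,0]$. Let $N\in\mathbb N$, $N\ge1$, $m_N=1/N$, $\overline x_i=X_{\rho_0}(i\,m_N)$ for $i=0,\dots,N$, and let $x_0(t),\dots,x_N(t)$ be the unique global solution to $$\dot x_i(t)=v\left(m_N\sum_{k=0}^N U(x_i(t)-x_k(t))-m_N\lambda(i+1)\right),\qquad x_i(0)=\overline x_i,\qquad i=0,\dots,N.$$ Then, for all $i=0,\dots,N-1$, $$x_{i+1}(t)-x_i(t)\ge\frac{m_N}{R}\qquad\text{for all }t\ge0,$$ and consequently, for all $t\ge0$, $\|\rho^N(\cdot,t)\|_{L^\infty(\mathbb R)}\le R$, where $$\rho^N(x,t)=\sum_{i=0}^{N-1}\frac{m_N}{x_{i+1}(t)-x_i(t)}\mathbf 1_{[x_i(t),x_{i+1}(t))}(x).$$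
   Context: Standing assumptions. The kernel $V:\mathbb R\to\mathbb R$ satisfies: $\mathrm{supp}(V)\subset(-\infty,0]$; $V$ is left-continuous at $0$ with $V(0)=V(0^-)=\lambda>0$; $V$ is Lipschitz continuous on $(-\infty,0]$. The velocity map $v:\mathbb R\to\mathbb R$ is Lipschitz, and there is $b>0$ such that $v(\rho_2)-v(\rho_1)\le -b(\rho_2-\rho_1)$ for all $\rho_2\ge\rho_1\ge0$. $U(x)=V(x)$ for $x\le0$, $U(x)=\lambda$ for $x>0$; it is globally Lipschitz. As long as $x_0\le\dots\le x_N$, the system is equivalent to $\dot x_i=v\big(m_N\sum_{k=i+1}^N V(x_i-x_k)\big)$. $X_{\rho_0}(z)=\inf\{x\in\mathbb R:\rho_0((-\infty,x])\ge z\}$ is the quantile function of $\rho_0$, identified with its right-continuous representative, with $X_{\rho_0}(0)=\min\mathrm{supp}\,\rho_0$ and $X_{\rho_0}(1)=\max\mathrm{supp}\,\rho_0$. *)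

theory Defs
  imports "HOL-Analysis.Analysis" "HOL-Probability.Probability"
    "HOL-Probability.Essential_Supremum"
begin

text \<open>The \<open>L\<^sup>\<infinity>\<close> norm is \<open>\<infinity>\<close> for essentially unbounded functions and (by the convention
  built into \<^const>\<open>esssup\<close>) for non-measurable ones, so that \<open>f\<close> belongs to \<open>L\<^sup>\<infinity>\<close> iff
  \<open>Linf_norm f < \<infinity>\<close>.\<close>

definition Linf_norm :: "(real \<Rightarrow> real) \<Rightarrow> ereal" where
  "Linf_norm f = esssup lborel (\<lambda>x. ereal \<bar>f x\<bar>)"

definition measure_supp :: "real measure \<Rightarrow> real set" where
  "measure_supp M = {x. \<forall>S. open S \<longrightarrow> x \<in> S \<longrightarrow> 0 < emeasure M S}"

text \<open>Only meaningful for \<open>0 < z < 1\<close>: otherwise the set below may be empty or unbounded below,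
  and the real-valued \<^const>\<open>Inf\<close> is then an arbitrary number.\<close>

definition quantile_inf :: "real measure \<Rightarrow> real \<Rightarrow> real" where
  "quantile_inf M z = Inf {x. cdf M x \<ge> z}"

text \<open>\<^const>\<open>quantile_inf\<close> is left-continuous and monotone on the open unit interval; its
  right-continuous representative is obtained by taking right limits.  For a compactly supported
  probability measure the support is compact and nonempty, so the infimum and supremum at the end
  points are its minimum and maximum.\<close>

definition quantile :: "real measure \<Rightarrow> real \<Rightarrow> real" where
  "quantile M z =
     (if z \<le> 0 then Inf (measure_supp M)
      else if z \<ge> 1 then Sup (measure_supp M)
      else Lim (at_right z) (quantile_inf M))"

definition extend_kernel :: "(real \<Rightarrow> real) \<Rightarrow> real \<Rightarrow> real \<Rightarrow> real" where
  "extend_kernel V lam x = (if x \<le> 0 then V x else lam)"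

definition discrete_density :: "nat \<Rightarrow> (nat \<Rightarrow> real \<Rightarrow> real) \<Rightarrow> real \<Rightarrow> real \<Rightarrow> real" where
  "discrete_density N x y t =
     (\<Sum>i<N. (1 / real N) / (x (i + 1) t - x i t) * indicator {x i t..<x (i + 1) t} y)"

end

theory Submission
  imports Defs
begin

text \<open>The cumulative distribution function of \<open>\<mu>\<close> is \<open>R\<close>-Lipschitz, so the initial
  gaps are at least \<open>m / R\<close>. Suppose that at some time all gaps are at least \<open>m / R\<close> and the gap
  between \<open>x\<^sub>i\<close> and \<open>x\<^sub>i\<^sub>+\<^sub>1\<close> equals \<open>m / R\<close>. Then every particle
  \<open>x\<^sub>k\<^sub>+\<^sub>1\<close> is at least as far ahead of \<open>x\<^sub>i\<^sub>+\<^sub>1\<close> as \<open>x\<^sub>k\<close> is ahead of \<open>x\<^sub>i\<close>, so by monotonicity of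
  \<open>V\<close> the nonlocal density seen by \<open>x\<^sub>i\<close> exceeds the one seen by \<open>x\<^sub>i\<^sub>+\<^sub>1\<close> by at least
  \<open>m * V (x\<^sub>i - x\<^sub>N) > 0\<close>. As \<open>v\<close> is strictly decreasing, the gap is strictly increasing at
  that time, and no gap can ever cross \<open>m / R\<close> downwards.\<close>

section \<open>Barrier argument for a finite family of differentiable functions\<close>

lemma barrier_real_derivative:
  fixes d D :: "'i \<Rightarrow> real \<Rightarrow> real"
  assumes fin: "finite I"
    and init: "\<And>i. i \<in> I \<Longrightarrow> \<delta> \<le> d i 0"
    and deriv: "\<And>i t. i \<in> I \<Longrightarrow> 0 \<le> t \<Longrightarrow> (d i has_real_derivative D i t) (at t within {0..})"
    and inward: "\<And>i t. i \<in> I \<Longrightarrow> 0 \<le> t \<Longrightarrow> (\<And>j. j \<in> I \<Longrightarrow> \<delta> \<le> d j t) \<Longrightarrow> d i t = \<delta> \<Longrightarrow> 0 < D i t"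
    and "i \<in> I" "0 \<le> t"
  shows "\<delta> \<le> d i t"
proof (rule ccontr)
  assume "\<not> \<delta> \<le> d i t"
  \<comment> \<open>\<open>B\<close> collects the times of violation. The bounds hold before its
    infimum \<open>T\<close>, at \<open>T\<close> by continuity, and on a right neighbourhood of
    \<open>T\<close>, which contradicts the choice of \<open>T\<close>.\<close>
  define B where "B = {s. 0 \<le> s \<and> (\<exists>j\<in>I. d j s < \<delta>)}"
  define T where "T = Inf B"
  have "t \<in> B"
    using \<open>\<not> \<delta> \<le> d i t\<close> \<open>i \<in> I\<close> \<open>0 \<le> t\<close> by (auto simp: B_def not_le)
  have bdd: "bdd_below B"
    by (auto simp: B_def intro!: bdd_belowI[of _ 0])
  have "0 \<le> T"
    unfolding T_def using \<open>t \<in> B\<close> by (intro cInf_greatest) (auto simp: B_def)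
  have before: "\<delta> \<le> d j s" if "j \<in> I" "0 \<le> s" "s < T" for j s
    using that cInf_lower[OF _ bdd, of s] by (auto simp: B_def T_def not_less[symmetric])
  have cont: "(d j \<longlongrightarrow> d j T) (at T within {0..})" if "j \<in> I" for j
    using deriv[OF that \<open>0 \<le> T\<close>] by (meson DERIV_continuous continuous_within)
  have at_T: "\<delta> \<le> d j T" if "j \<in> I" for j
  proof (cases "T = 0")
    case True
    then show ?thesis using init that by simp
  next
    case False
    then have "0 < T" using \<open>0 \<le> T\<close> by simp
    have "(d j \<longlongrightarrow> d j T) (at T within {0..<T})"
      using cont[OF that] by (rule tendsto_within_subset) auto
    moreover have "at T within {0..<T} = at_left T"
      using \<open>0 < T\<close> by (intro at_within_nhd[of _ "{0<..}"]) auto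
    ultimately have "(d j \<longlongrightarrow> d j T) (at_left T)" by simp
    moreover have "eventually (\<lambda>s. \<delta> \<le> d j s) (at_left T)"
      using eventually_at_left_real[OF \<open>0 < T\<close>] by eventually_elim (auto intro: before[OF that])
    ultimately show ?thesis
      by (rule tendsto_lowerbound) simp
  qed
  have "eventually (\<lambda>s. \<delta> \<le> d j s) (at_right T)" if "j \<in> I" for j
  proof (cases "d j T = \<delta>")
    case True
    \<comment> \<open>\<open>inward\<close> presupposes the bounds for the whole family at the
      touching time, so \<open>at_T\<close> has to come first.\<close>
    then have "0 < D j T" using inward[OF that \<open>0 \<le> T\<close>] at_T by blast
    from has_real_derivative_pos_inc_right[OF deriv[OF that \<open>0 \<le> T\<close>] this]
    obtain e where e: "e > 0" "\<And>h. 0 < h \<Longrightarrow> h < e \<Longrightarrow> d j T < d j (T + h)"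
      using \<open>0 \<le> T\<close> by auto
    have "\<delta> \<le> d j s" if "T < s" "s < T + e" for s
      using e(2)[of "s - T"] that True by auto
    then show ?thesis
      using \<open>e > 0\<close> unfolding eventually_at_right_field by (intro exI[of _ "T + e"]) auto
  next
    case False
    then have "\<delta> < d j T" using at_T[OF that] by simp
    moreover have "(d j \<longlongrightarrow> d j T) (at_right T)"
      using cont[OF that] by (rule tendsto_within_subset) (use \<open>0 \<le> T\<close> in auto)
    ultimately have "eventually (\<lambda>s. \<delta> < d j s) (at_right T)"
      by (rule order_tendstoD(1)[rotated])
    then show ?thesis by eventually_elim simp
  qed
  \<comment> \<open>Finiteness of \<open>I\<close> yields one right neighbourhood of
    \<open>T\<close> that serves all indices.\<close>
  then have "eventually (\<lambda>s. \<forall>j\<in>I. \<delta> \<le> d j s) (at_right T)"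
    using fin by (simp add: eventually_ball_finite)
  then obtain c where c: "T < c" "\<And>s j. T < s \<Longrightarrow> s < c \<Longrightarrow> j \<in> I \<Longrightarrow> \<delta> \<le> d j s"
    unfolding eventually_at_right_field by blast
  have "c \<le> s" if "s \<in> B" for s
  proof (rule ccontr)
    assume "\<not> c \<le> s"
    obtain j where j: "j \<in> I" "d j s < \<delta>" and "0 \<le> s"
      using \<open>s \<in> B\<close> by (auto simp: B_def)
    show False
      using before[OF j(1) \<open>0 \<le> s\<close>] at_T[OF j(1)] c(2)[OF _ _ j(1), of s] j(2) \<open>\<not> c \<le> s\<close>
      by (cases s T rule: linorder_cases) auto
  qed
  then have "c \<le> T"
    unfolding T_def using \<open>t \<in> B\<close> by (intro cInf_greatest) auto
  with \<open>T < c\<close> show False by simp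
qed

section \<open>Quantiles of a distribution with continuous cdf and compact support\<close>

context real_distribution
begin

text \<open>The limits 0 and 1 of the cdf make the superlevel set nonempty and bounded below, so the
  real \<open>Inf\<close> is a genuine infimum. Continuity closes the set, hence the infimum has cdf
  at least \<open>z\<close>; it lies below a point of cdf exactly \<open>z\<close> given by the
  intermediate value theorem.\<close>

lemma cdf_quantile_inf:
  assumes cont: "\<And>y. isCont (cdf M) y" and z: "0 < z" "z < 1"
  shows "cdf M (quantile_inf M z) = z"
    and "bdd_below {y. z \<le> cdf M y}"
    and "{y. z \<le> cdf M y} \<noteq> {}"
proof -
  let ?S = "{y. z \<le> cdf M y}"
  obtain l where l: "cdf M l < z"
    using eventually_happens[OF order_tendstoD(2)[OF cdf_lim_at_bot z(1)]] by auto
  obtain u where u: "z < cdf M u"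
    using eventually_happens[OF order_tendstoD(1)[OF cdf_lim_at_top_prob z(2)]] by auto
  have "l \<le> u"
    using cdf_nondecreasing[of u l] l u by linarith
  with l u obtain y where y: "cdf M y = z"
    using IVT[of "cdf M" l z u] cont by auto
  show bdd: "bdd_below ?S"
  proof (rule bdd_belowI[of _ l])
    fix u assume "u \<in> ?S"
    then show "l \<le> u" using l cdf_nondecreasing[of u l] by (cases "l \<le> u") auto
  qed
  show ne: "?S \<noteq> {}" using u by (auto intro!: exI[of _ u])
  have "closed ?S"
    using cont by (intro closed_Collect_le) (auto simp: continuous_on_eq_continuous_at)
  then have "Inf ?S \<in> ?S"
    by (rule closed_contains_Inf[OF ne bdd])
  moreover have "Inf ?S \<le> y"
    using y bdd by (intro cInf_lower) auto
  ultimately show "cdf M (quantile_inf M z) = z"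
    using cdf_nondecreasing[of "Inf ?S" y] y by (simp add: quantile_inf_def)
qed

lemma quantile_inf_mono:
  assumes "\<And>y. isCont (cdf M) y" and "0 < z" "z \<le> w" "w < 1"
  shows "quantile_inf M z \<le> quantile_inf M w"
  unfolding quantile_inf_def using assms
  by (intro cInf_superset_mono cdf_quantile_inf) auto

text \<open>\<open>Lim\<close> carries information only once the limit exists. Monotonicity provides
  it, as the infimum of the values to the right of \<open>z\<close>.\<close>

lemma quantile_inf_tendsto_quantile:
  assumes cont: "\<And>y. isCont (cdf M) y" and z: "0 < z" "z < 1"
  shows "(quantile_inf M \<longlongrightarrow> quantile M z) (at_right z)"
proof -
  let ?Q = "quantile_inf M"
  define L where "L = Inf (?Q ` {z<..<1})"
  have bdd: "bdd_below (?Q ` {z<..<1})"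
    using quantile_inf_mono[OF cont z(1)] by (intro bdd_belowI[of _ "?Q z"]) auto
  have "(?Q \<longlongrightarrow> L) (at_right z)"
  proof (rule order_tendstoI)
    fix a assume "a < L"
    have "a < ?Q u" if "z < u" "u < 1" for u
      using cInf_lower[OF _ bdd, of "?Q u"] that \<open>a < L\<close> by (force simp: L_def)
    then show "eventually (\<lambda>u. a < ?Q u) (at_right z)"
      using z unfolding eventually_at_right_field by blast
  next
    fix a assume "L < a"
    then obtain w where w: "z < w" "w < 1" "?Q w < a"
      using cInf_lessD[of "?Q ` {z<..<1}" a] z by (auto simp: L_def)
    then have "?Q u < a" if "z < u" "u < w" for u
      using quantile_inf_mono[OF cont, of u w] that z by auto
    then show "eventually (\<lambda>u. ?Q u < a) (at_right z)"
      using w(1) unfolding eventually_at_right_field by blast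
  qed
  moreover from this have "quantile M z = L"
    using z by (simp add: quantile_def tendsto_Lim)
  ultimately show ?thesis by simp
qed

text \<open>The complement is the union of all open null sets, possibly uncountably many; by
  Lindelof countably many of them suffice.\<close>

lemma emeasure_Compl_measure_supp: "emeasure M (- measure_supp M) = 0"
proof -
  let ?F = "{S. open S \<and> emeasure M S = 0}"
  obtain F' where F': "F' \<subseteq> ?F" "countable F'" "\<Union>F' = \<Union>?F"
    using Lindelof[of ?F] by auto
  have "- measure_supp M = \<Union>?F"
    by (auto simp: measure_supp_def)
  moreover have "(\<Union>S\<in>F'. S) \<in> null_sets M"
    using F'(1,2) by (intro null_sets_UN') (auto simp: null_sets_def)
  ultimately show ?thesis
    using F'(3) by (auto simp: null_sets_def)
qed

lemma measure_eq_0_if_disjoint_measure_supp: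
  assumes "A \<inter> measure_supp M = {}"
  shows "measure M A = 0"
proof -
  have "closed (measure_supp M)"
  proof -
    have "- measure_supp M = \<Union>{S. open S \<and> emeasure M S = 0}"
      by (auto simp: measure_supp_def)
    then show ?thesis by (simp add: closed_def open_Union)
  qed
  then have "emeasure M A \<le> emeasure M (- measure_supp M)"
    using assms by (intro emeasure_mono) (auto simp: borel_closed)
  then show ?thesis
    by (simp add: emeasure_Compl_measure_supp measure_def)
qed

text \<open>No mass lies outside the support, which settles the end points; in the interior the
  identity for \<open>quantile_inf\<close> passes to the right limit by continuity of the
  cdf.\<close>

lemma cdf_quantile:
  assumes cont: "\<And>y. isCont (cdf M) y" and supp: "compact (measure_supp M)"
    and z: "0 \<le> z" "z \<le> 1"
  shows "cdf M (quantile M z) = z"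
proof -
  let ?S = "measure_supp M"
  have "?S \<noteq> {}"
    using measure_eq_0_if_disjoint_measure_supp[of UNIV] prob_space by auto
  have bdd: "bdd_below ?S" "bdd_above ?S"
    using supp by (auto intro: bounded_imp_bdd_below bounded_imp_bdd_above compact_imp_bounded)
  consider "z = 0" | "z = 1" | "0 < z" "z < 1" using z by linarith
  then show ?thesis
  proof cases
    case 1
    have "measure M {..<Inf ?S} = 0"
      using cInf_lower[OF _ bdd(1)] by (intro measure_eq_0_if_disjoint_measure_supp) force
    \<comment> \<open>The left limit of the cdf is the mass strictly below \<open>Inf ?S\<close>;
      continuity identifies it with the value there.\<close>
    then have "cdf M (Inf ?S) = 0"
      using tendsto_unique[OF _ cdf_at_left continuous_within[THEN iffD1,
            OF continuous_at_imp_continuous_at_within[OF cont]]] by simp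
    with 1 show ?thesis by (simp add: quantile_def)
  next
    case 2
    have "measure M {Sup ?S<..} = 0"
      using cSup_upper[OF _ bdd(2)] by (intro measure_eq_0_if_disjoint_measure_supp) force
    moreover have "{Sup ?S<..} = space M - {..Sup ?S}" by auto
    ultimately have "cdf M (Sup ?S) = 1"
      using prob_compl[of "{..Sup ?S}"] by (simp add: cdf_def)
    with 2 show ?thesis by (simp add: quantile_def)
  next
    case 3
    have "((\<lambda>w. cdf M (quantile_inf M w)) \<longlongrightarrow> cdf M (quantile M z)) (at_right z)"
      by (rule isCont_tendsto_compose[OF cont quantile_inf_tendsto_quantile[OF cont 3]])
    moreover have "eventually (\<lambda>w. cdf M (quantile_inf M w) = w) (at_right z)"
      using 3 cdf_quantile_inf(1)[OF cont] unfolding eventually_at_right_field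
      by (intro exI[of _ 1]) auto
    ultimately have "((\<lambda>w. w) \<longlongrightarrow> cdf M (quantile M z)) (at_right z)"
      by (rule Lim_transform_eventually)
    then show ?thesis
      using tendsto_unique tendsto_ident_at trivial_limit_at_right_real by blast
  qed
qed

end

section \<open>From the essential bound on the density to lower bounds on quantile gaps\<close>

lemma emeasure_density_le_of_Linf_norm:
  fixes f :: "real \<Rightarrow> real"
  assumes [measurable]: "f \<in> borel_measurable borel" "A \<in> sets borel"
    and fin: "Linf_norm f < \<infinity>"
  shows "emeasure (density lborel (\<lambda>y. ennreal (f y))) A
      \<le> ennreal (real_of_ereal (Linf_norm f)) * emeasure lborel A"
proof -
  let ?R = "real_of_ereal (Linf_norm f)"
  have AE: "AE y in lborel. ereal \<bar>f y\<bar> \<le> Linf_norm f"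
    unfolding Linf_norm_def by (rule esssup_AE)
  have "AE y in lborel. f y \<le> ?R"
    using AE
  proof eventually_elim
    \<comment> \<open>\<open>real_of_ereal\<close> maps infinite values to 0. Plus infinity is
      excluded by \<open>fin\<close>, minus infinity because the norm dominates an absolute
      value.\<close>
    case (elim y)
    then show ?case using fin by (cases "Linf_norm f") auto
  qed
  then have "AE y in lborel. ennreal (f y) * indicator A y \<le> ennreal ?R * indicator A y"
    by eventually_elim (auto intro: mult_right_mono ennreal_leI)
  then have "(\<integral>\<^sup>+y. ennreal (f y) * indicator A y \<partial>lborel) \<le> (\<integral>\<^sup>+y. ennreal ?R * indicator A y \<partial>lborel)"
    by (rule nn_integral_mono_AE)
  then show ?thesis
    by (simp add: emeasure_density nn_integral_cmult_indicator)
qed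

lemma cdf_diff_le_of_Linf_norm:
  fixes f :: "real \<Rightarrow> real"
  assumes f: "f \<in> borel_measurable borel" and fin: "Linf_norm f < \<infinity>"
    and M: "M = density lborel (\<lambda>y. ennreal (f y))" and "prob_space M" and "a \<le> c"
  shows "cdf M c - cdf M a \<le> real_of_ereal (Linf_norm f) * (c - a)"
proof -
  interpret prob_space M by fact
  interpret real_distribution M by standard (simp add: M)
  \<comment> \<open>\<open>ennreal\<close> truncates negative numbers to 0, so the return to real
    inequalities below relies on this sign.\<close>
  have "0 \<le> esssup lborel (\<lambda>y. ereal \<bar>f y\<bar>)"
    using esssup_mono[of "\<lambda>_. 0::ereal" lborel "\<lambda>y. ereal \<bar>f y\<bar>"] esssup_const[of "lborel :: real measure" "0::ereal"]
    by simp
  then have R0: "0 \<le> real_of_ereal (Linf_norm f)"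
    by (simp add: Linf_norm_def real_of_ereal_pos)
  have "ennreal (cdf M c - cdf M a) = emeasure M {a<..c}"
    using \<open>a \<le> c\<close> by (simp add: emeasure_Ioc)
  also have "\<dots> \<le> ennreal (real_of_ereal (Linf_norm f)) * emeasure lborel {a<..c}"
    unfolding M by (intro emeasure_density_le_of_Linf_norm f fin) simp
  also have "\<dots> = ennreal (real_of_ereal (Linf_norm f) * (c - a))"
    using \<open>a \<le> c\<close> R0 by (simp add: ennreal_mult)
  finally show ?thesis
    using R0 \<open>a \<le> c\<close> by (simp add: ennreal_le_iff)
qed

text \<open>Between the two quantiles lies mass exactly \<open>w - z\<close>, while the density
  bound allows at most the norm times their distance. Since this mass is positive, the norm cannot
  vanish.\<close>

lemma quantile_diff_ge_of_Linf_norm: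
  fixes f :: "real \<Rightarrow> real"
  assumes f: "f \<in> borel_measurable borel" and fin: "Linf_norm f < \<infinity>"
    and M: "M = density lborel (\<lambda>y. ennreal (f y))" and prob: "prob_space M"
    and supp: "compact (measure_supp M)"
    and z: "0 \<le> z" "z < w" "w \<le> 1"
  shows "0 < real_of_ereal (Linf_norm f)"
    and "(w - z) / real_of_ereal (Linf_norm f) \<le> quantile M w - quantile M z"
proof -
  let ?R = "real_of_ereal (Linf_norm f)"
  interpret prob_space M by fact
  interpret real_distribution M by standard (simp add: M)
  \<comment> \<open>Points are Lebesgue null, so there are no atoms and the cdf is
    continuous.\<close>
  have "measure M {y} = 0" for y
    using emeasure_density_le_of_Linf_norm[OF f _ fin, of "{y}"] by (simp add: M measure_def)
  then have "isCont (cdf M) y" for y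
    by (simp add: isCont_cdf)
  then have cq: "cdf M (quantile M z) = z" "cdf M (quantile M w) = w"
    using z by (auto intro: cdf_quantile supp)
  then have less: "quantile M z < quantile M w"
    using cdf_nondecreasing[of "quantile M w" "quantile M z"] z by fastforce
  then have le: "w - z \<le> ?R * (quantile M w - quantile M z)"
    using cdf_diff_le_of_Linf_norm[OF f fin M prob, of "quantile M z" "quantile M w"] cq by simp
  then have "0 < ?R * (quantile M w - quantile M z)"
    using z by linarith
  then show "0 < ?R"
    using less by (simp add: zero_less_mult_iff)
  with le show "(w - z) / ?R \<le> quantile M w - quantile M z"
    by (simp add: divide_le_eq mult.commute)
qed

section \<open>Ordered particles and the nonlocal density they see\<close>

lemma gaps_imp_le:
  fixes y :: "nat \<Rightarrow> real"
  assumes gaps: "\<And>j. j < N \<Longrightarrow> 0 \<le> y (Suc j) - y j" and "i \<le> k" "k \<le> N"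
  shows "y i \<le> y k"
  using \<open>i \<le> k\<close> \<open>k \<le> N\<close>
proof (induction rule: dec_induct)
  case (step n)
  then show ?case using gaps[of n] by simp
qed simp

text \<open>The \<open>i + 1\<close> particles with index at most \<open>i\<close> each contribute
  \<open>lam\<close>, also when they coincide with particle \<open>i\<close>, because
  \<open>V 0 = lam\<close>. The subtracted term cancels exactly these, so only particles ahead
  count.\<close>

lemma sum_extend_kernel_ordered:
  assumes ordered: "\<And>j k. j \<le> k \<Longrightarrow> k \<le> N \<Longrightarrow> y j \<le> y k" and V0: "V 0 = lam" and "i \<le> N"
  shows "(\<Sum>k=0..N. extend_kernel V lam (y i - y k)) - lam * (real i + 1)
       = (\<Sum>k=Suc i..N. V (y i - y k))"
proof -
  have split: "{0..N} = {0..i} \<union> {Suc i..N}" using \<open>i \<le> N\<close> by auto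
  have "(\<Sum>k=0..i. extend_kernel V lam (y i - y k)) = (\<Sum>k=0..i. lam)"
  proof (rule sum.cong)
    fix k assume "k \<in> {0..i}"
    then have "y k \<le> y i" using ordered \<open>i \<le> N\<close> by simp
    then show "extend_kernel V lam (y i - y k) = lam"
      by (cases "y k = y i") (auto simp: extend_kernel_def V0)
  qed simp
  moreover have "(\<Sum>k=Suc i..N. extend_kernel V lam (y i - y k)) = (\<Sum>k=Suc i..N. V (y i - y k))"
    using ordered by (intro sum.cong) (auto simp: extend_kernel_def)
  ultimately show ?thesis
    by (simp add: split sum.union_disjoint algebra_simps)
qed

lemma nonlocal_density_less_of_min_gap:
  fixes V :: "real \<Rightarrow> real"
  assumes gaps: "\<And>j. j < N \<Longrightarrow> \<delta> \<le> y (Suc j) - y j" and "0 \<le> \<delta>"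
    and "i < N" and min_gap: "y (Suc i) - y i = \<delta>"
    and mono: "mono_on {..0} V" and pos: "\<forall>z\<le>0. 0 < V z"
  shows "(\<Sum>k=Suc (Suc i)..N. V (y (Suc i) - y k)) < (\<Sum>k=Suc i..N. V (y i - y k))"
proof -
  obtain N' where N': "N = Suc N'" using \<open>i < N\<close> by (cases N) auto
  have gaps0: "0 \<le> y (Suc j) - y j" if "j < N" for j
    using gaps[OF that] \<open>0 \<le> \<delta>\<close> by linarith
  have ordered: "y j \<le> y k" if "j \<le> k" "k \<le> N" for j k
    by (rule gaps_imp_le[of N y, OF gaps0 that])
  \<comment> \<open>The index shift pairs particle \<open>Suc k\<close>, seen from
    \<open>Suc i\<close>, with particle \<open>k\<close>, seen from \<open>i\<close>.\<close>
  have "(\<Sum>k=Suc (Suc i)..N. V (y (Suc i) - y k)) = (\<Sum>k=Suc i..N'. V (y (Suc i) - y (Suc k)))"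
    unfolding N' by (rule sum.shift_bounds_cl_Suc_ivl)
  also have "\<dots> \<le> (\<Sum>k=Suc i..N'. V (y i - y k))"
  proof (intro sum_mono mono_onD[OF mono])
    \<comment> \<open>Gap \<open>k\<close> is at least the minimal gap \<open>i\<close>; rearranged,
      this compares the two arguments of \<open>V\<close>.\<close>
    fix k assume k: "k \<in> {Suc i..N'}"
    then show "y (Suc i) - y (Suc k) \<le> y i - y k"
      using gaps[of k] min_gap N' by auto
    show "y (Suc i) - y (Suc k) \<in> {..0}" "y i - y k \<in> {..0}"
      using k N' ordered[of "Suc i" "Suc k"] ordered[of i k] by auto
  qed
  \<comment> \<open>The unpaired term \<open>V (y i - y N)\<close> is positive and gives
    strictness.\<close>
  also have "\<dots> < (\<Sum>k=Suc i..N. V (y i - y k))"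
    using pos ordered[of i N] \<open>i < N\<close> by (simp add: N')
  finally show ?thesis .
qed

text \<open>Ordering makes the half-open cells disjoint, so at most one summand is nonzero at a
  point, and each is at most \<open>R\<close> by its gap. Nonnegativity serves to remove the
  absolute value in \<open>Linf_norm\<close>.\<close>

lemma discrete_density_bounds:
  assumes gaps: "\<And>i. i < N \<Longrightarrow> 1 / real N / R \<le> x (Suc i) t - x i t" and "0 < N" "0 < R"
  shows "0 \<le> discrete_density N x y t" "discrete_density N x y t \<le> R"
proof -
  let ?f = "\<lambda>i. (1 / real N) / (x (i + 1) t - x i t) * indicator {x i t..<x (i + 1) t} y"
  have pos: "0 < 1 / real N / R" using assms by simp
  have gap0: "0 \<le> x (Suc i) t - x i t" if "i < N" for i
    using gaps[OF that] pos by linarith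
  have bound: "?f i \<le> R" if "i < N" for i
  proof -
    have "0 < x (Suc i) t - x i t"
      using gaps[OF that] pos by linarith
    then have "(1 / real N) / (x (Suc i) t - x i t) \<le> R"
      using gaps[OF that] \<open>0 < R\<close> by (simp only: pos_divide_le_eq mult.commute)
    then show ?thesis using \<open>0 < R\<close> by (simp split: split_indicator)
  qed
  show "0 \<le> discrete_density N x y t"
    unfolding discrete_density_def using gap0 by (intro sum_nonneg mult_nonneg_nonneg divide_nonneg_nonneg) auto
  show "discrete_density N x y t \<le> R"
  proof (cases "\<exists>j<N. y \<in> {x j t..<x (j + 1) t}")
    case True
    then obtain j where j: "j < N" "x j t \<le> y" "y < x (Suc j) t" by auto
    have "?f i = 0" if "i < N" "i \<noteq> j" for i
    proof -
      consider "Suc i \<le> j" | "Suc j \<le> i" using \<open>i \<noteq> j\<close> by arith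
      then have "y \<notin> {x i t..<x (i + 1) t}"
      proof cases
        case 1
        then show ?thesis using gaps_imp_le[of N "\<lambda>i. x i t" "Suc i" j] gap0 j by auto
      next
        case 2
        then show ?thesis using gaps_imp_le[of N "\<lambda>i. x i t" "Suc j" i] gap0 j that by auto
      qed
      then show ?thesis by simp
    qed
    then have "discrete_density N x y t = ?f j"
      unfolding discrete_density_def using j(1)
      by (subst sum.remove[of _ j]) (simp_all add: sum.neutral)
    then show ?thesis using bound[OF j(1)] by simp
  next
    case False
    then have "discrete_density N x y t = 0"
      unfolding discrete_density_def by (intro sum.neutral) auto
    then show ?thesis using \<open>0 < R\<close> by simp
  qed
qed

section \<open>The gap bound along the flow and the resulting density bound\<close>

theorem proposition4p1:
  fixes V v \<rho>\<^sub>0 :: "real \<Rightarrow> real" and lam b R m :: real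
    and \<mu> :: "real measure" and U :: "real \<Rightarrow> real"
    and N :: nat and x :: "nat \<Rightarrow> real \<Rightarrow> real"
  assumes V_supp: "closure {y. V y \<noteq> 0} \<subseteq> {..0}"
    and V_left: "(V \<longlongrightarrow> lam) (at_left 0)" and V_0: "V 0 = lam" and lam_pos: "lam > 0"
    and V_lip: "\<exists>L. L-lipschitz_on {..0} V"
    and v_lip: "\<exists>L. L-lipschitz_on UNIV v"
    and b_pos: "b > 0"
    and v_decr: "\<forall>r1 r2. 0 \<le> r1 \<longrightarrow> r1 \<le> r2 \<longrightarrow> v r2 - v r1 \<le> - b * (r2 - r1)"
    and V_pos: "\<forall>y\<le>0. V y > 0"
    and V_mono: "mono_on {..0} V"
    and U_def: "U = extend_kernel V lam"
    and rho_meas: "\<rho>\<^sub>0 \<in> borel_measurable borel"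
    and rho_nonneg: "AE y in lborel. 0 \<le> \<rho>\<^sub>0 y"
    and mu_def: "\<mu> = density lborel (\<lambda>y. ennreal (\<rho>\<^sub>0 y))"
    and mu_prob: "prob_space \<mu>"
    and mu_supp: "compact (measure_supp \<mu>)"
    and rho_Linf: "Linf_norm \<rho>\<^sub>0 < \<infinity>"
    and R_def: "R = real_of_ereal (Linf_norm \<rho>\<^sub>0)"
    and N_ge: "N \<ge> 1"
    and m_def: "m = 1 / real N"
    and init: "\<forall>i\<le>N. x i 0 = quantile \<mu> (real i * m)"
    and ode: "\<forall>i\<le>N. \<forall>t\<ge>0.
        (x i has_real_derivative
           v (m * (\<Sum>k=0..N. U (x i t - x k t)) - m * lam * (real i + 1)))
        (at t within {0..})"
  shows "(\<forall>i<N. \<forall>t\<ge>0. x (i + 1) t - x i t \<ge> m / R) \<and>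
         (\<forall>t\<ge>0. Linf_norm (\<lambda>y. discrete_density N x y t) \<le> ereal R)"
proof -
  have N: "0 < N" and m: "0 < m" "real N * m = 1"
    using N_ge by (auto simp: m_def)
  have grid: "0 \<le> real i * m" "real i * m < real (Suc i) * m" "real (Suc i) * m \<le> 1" if "i < N" for i
  proof -
    have "real (Suc i) * m \<le> real N * m"
      using that m(1) by (intro mult_right_mono) auto
    then show "real (Suc i) * m \<le> 1" using m(2) by simp
  qed (use m(1) in auto)
  note q = quantile_diff_ge_of_Linf_norm[OF rho_meas rho_Linf mu_def mu_prob mu_supp grid,
      folded R_def]
  have R: "0 < R" using q(1) N by blast
  define w where "w i t = m * (\<Sum>k=0..N. U (x i t - x k t)) - m * lam * (real i + 1)" for i t
  have gap: "m / R \<le> x (Suc i) t - x i t" if "i < N" "0 \<le> t" for i t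
  proof (rule barrier_real_derivative[where I = "{..<N}" and d = "\<lambda>i t. x (Suc i) t - x i t"
        and D = "\<lambda>i t. v (w (Suc i) t) - v (w i t)"])
    fix i assume "i \<in> {..<N}"
    then show "m / R \<le> x (Suc i) 0 - x i 0"
      using q(2)[of i] init by (simp add: algebra_simps)
  next
    fix i and t :: real assume "i \<in> {..<N}" "0 \<le> t"
    then show "((\<lambda>t. x (Suc i) t - x i t) has_real_derivative v (w (Suc i) t) - v (w i t))
        (at t within {0..})"
      unfolding w_def by (intro DERIV_diff ode[rule_format]) auto
  next
    fix i and t :: real
    assume i: "i \<in> {..<N}" and t: "0 \<le> t"
      and gaps: "\<And>j. j \<in> {..<N} \<Longrightarrow> m / R \<le> x (Suc j) t - x j t"
      and eq: "x (Suc i) t - x i t = m / R"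
    have gaps0: "0 \<le> x (Suc j) t - x j t" if "j < N" for j
      using gaps[of j] that divide_pos_pos[OF m(1) R] by simp
    have ordered: "x j t \<le> x k t" if "j \<le> k" "k \<le> N" for j k
      by (rule gaps_imp_le[of N "\<lambda>i. x i t", OF gaps0 that])
    have w: "w j t = m * (\<Sum>k=Suc j..N. V (x j t - x k t))" if "j \<le> N" for j
    proof -
      have "w j t = m * ((\<Sum>k=0..N. extend_kernel V lam (x j t - x k t)) - lam * (real j + 1))"
        by (simp add: w_def U_def algebra_simps)
      then show ?thesis
        using sum_extend_kernel_ordered[where V = V and lam = lam and y = "\<lambda>i. x i t", OF ordered V_0 that] by simp
    qed
    \<comment> \<open>\<open>v_decr\<close> speaks only of nonnegative arguments, so the smaller
      density must be checked; for \<open>Suc i = N\<close> it is an empty sum.\<close>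
    have "0 \<le> w (Suc i) t"
      using i m(1) ordered V_pos
      by (subst w) (auto intro!: mult_nonneg_nonneg sum_nonneg intro: less_imp_le)
    moreover have "w (Suc i) t < w i t"
      using nonlocal_density_less_of_min_gap[where y = "\<lambda>i. x i t" and \<delta> = "m / R", OF gaps _ _ eq V_mono V_pos]
        i m(1) R by (simp add: w)
    ultimately have "v (w i t) - v (w (Suc i) t) \<le> - b * (w i t - w (Suc i) t)"
      using v_decr by simp
    also have "\<dots> < 0"
      using b_pos \<open>w (Suc i) t < w i t\<close> by simp
    finally show "0 < v (w (Suc i) t) - v (w i t)" by simp
  qed (use that in auto)
  have "Linf_norm (\<lambda>y. discrete_density N x y t) \<le> ereal R" if "0 \<le> t" for t
    unfolding Linf_norm_def
  proof (rule esssup_I)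
    \<comment> \<open>Without measurability \<open>esssup\<close> would be infinite by convention,
      whatever the pointwise bound.\<close>
    show "(\<lambda>y. ereal \<bar>discrete_density N x y t\<bar>) \<in> borel_measurable lborel"
      unfolding discrete_density_def by measurable
    have "\<bar>discrete_density N x y t\<bar> \<le> R" for y
      using discrete_density_bounds[of N R x t y] gap that N R by (simp add: m_def)
    then show "AE y in lborel. ereal \<bar>discrete_density N x y t\<bar> \<le> ereal R" by simp
  qed
  with gap show ?thesis by simp
qed

end
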